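(* Let $K$ be a field of arbitrary characteristic, let $\Phi \leq \mathrm{GL}_m(K)$ and $G \leq \mathrm{GL}_n(K)$ be subgroups, and let $\Phi \ltimes G$ be a semidirect product of $\Phi$ and $G$ with $G$ normal, where $\Phi$ acts on $G$ by automorphisms. Suppose that for every $\varphi \in \Phi$ there is an element $g_\varphi \in \mathrm{GL}_n(K)$ such that $$\varphi^{-1} g \varphi = g_\varphi^{-1}\, g\, g_\varphi \quad \text{for all } g \in G,$$ where the left-hand side is computed in $\Phi \ltimes G$. Then the group $\Phi \ltimes G$ has a faithful linear representation by matrices of size $\leq m^2 + n^4$ over the field $K$.
   Context: The semidirect product $\Phi \ltimes G$ consists of pairs $(\varphi, g)$, $\varphi\in\Phi$, $g\in G$, with multiplication $(\varphi_1,g_1)(\varphi_2,g_2) = (\varphi_1\varphi_2,\, g_1^{\varphi_2} g_2)$, where $g^{\varphi} = \varphi^{-1} g \varphi \in G$ denotes the image of $g$ under the (right) action of $\varphi$ on $G$ by automorphisms. The action is an abstract one (part of the data of the semidirect product); the product $\varphi^{-1} g\varphi$ is not a product of matrices. A faithful linear representation of a group $H$ by matrices of size $d$ over $K$ is an injective homomorphism $H \to \mathrm{GL}_d(K)$. *)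

theory Defs
  imports "Jordan_Normal_Form.Matrix"
begin

definition GL :: "nat \<Rightarrow> 'k::field mat monoid" where
  "GL n = units_of (ring_mat TYPE('k) n ())"

text \<open>A right action of \<open>H\<close> on \<open>N\<close> by group automorphisms; \<open>act h x\<close> is written $x^h$ on paper.\<close>

definition acts_by_automorphisms ::
    "('a, 'c) monoid_scheme \<Rightarrow> ('b, 'd) monoid_scheme \<Rightarrow> ('a \<Rightarrow> 'b \<Rightarrow> 'b) \<Rightarrow> bool" where
  "acts_by_automorphisms H N act \<longleftrightarrow>
     (\<forall>h\<in>carrier H. act h \<in> iso N N) \<and>
     (\<forall>x\<in>carrier N. act \<one>\<^bsub>H\<^esub> x = x) \<and>
     (\<forall>h\<in>carrier H. \<forall>k\<in>carrier H. \<forall>x\<in>carrier N. act (h \<otimes>\<^bsub>H\<^esub> k) x = act k (act h x))"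

definition semidirect ::
    "('a, 'c) monoid_scheme \<Rightarrow> ('b, 'd) monoid_scheme \<Rightarrow> ('a \<Rightarrow> 'b \<Rightarrow> 'b) \<Rightarrow> ('a \<times> 'b) monoid" where
  "semidirect H N act =
     \<lparr>carrier = carrier H \<times> carrier N,
      mult = (\<lambda>(h, x) (k, y). (h \<otimes>\<^bsub>H\<^esub> k, act k x \<otimes>\<^bsub>N\<^esub> y)),
      one = (\<one>\<^bsub>H\<^esub>, \<one>\<^bsub>N\<^esub>)\<rparr>"

definition has_faithful_rep :: "('a, 'c) monoid_scheme \<Rightarrow> 'k::field itself \<Rightarrow> nat \<Rightarrow> bool" where
  "has_faithful_rep H _ d \<longleftrightarrow>
     (\<exists>\<rho> :: 'a \<Rightarrow> 'k mat. \<rho> \<in> hom H (GL d) \<and> inj_on \<rho> (carrier H))"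

lemma group_GL: "group (GL n)"
proof -
  interpret ring "ring_mat TYPE('a::field) n ()" by (rule ring_mat)
  show "group (GL n :: 'a mat monoid)"
    unfolding GL_def by (rule units_group)
qed

lemma group_semidirect:
  assumes "group H" and "group N" and act: "acts_by_automorphisms H N act"
  shows "group (semidirect H N act)"
proof -
  interpret H: group H by fact
  interpret N: group N by fact
  have auto: "act h \<in> hom N N" if "h \<in> carrier H" for h
    using act that by (auto simp: acts_by_automorphisms_def iso_def)
  have closed [simp]: "act h x \<in> carrier N" if "h \<in> carrier H" "x \<in> carrier N" for h x
    using auto that by (auto simp: hom_def)
  have mult [simp]: "act h (x \<otimes>\<^bsub>N\<^esub> y) = act h x \<otimes>\<^bsub>N\<^esub> act h y"
    if "h \<in> carrier H" "x \<in> carrier N" "y \<in> carrier N" for h x y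
    using auto that by (auto simp: hom_def)
  have one [simp]: "act h \<one>\<^bsub>N\<^esub> = \<one>\<^bsub>N\<^esub>" if "h \<in> carrier H" for h
    using hom_one[OF auto[OF that]] N.group_axioms by simp
  have id [simp]: "act \<one>\<^bsub>H\<^esub> x = x" if "x \<in> carrier N" for x
    using act that by (auto simp: acts_by_automorphisms_def)
  have comp: "act (h \<otimes>\<^bsub>H\<^esub> k) x = act k (act h x)"
    if "h \<in> carrier H" "k \<in> carrier H" "x \<in> carrier N" for h k x
    using act that by (auto simp: acts_by_automorphisms_def)
  show ?thesis
  proof (rule groupI)
    fix p assume "p \<in> carrier (semidirect H N act)"
    then obtain h x where p: "p = (h, x)" "h \<in> carrier H" "x \<in> carrier N"
      by (auto simp: semidirect_def)
    show "\<exists>q\<in>carrier (semidirect H N act).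
        q \<otimes>\<^bsub>semidirect H N act\<^esub> p = \<one>\<^bsub>semidirect H N act\<^esub>"
      by (rule bexI[of _ "(inv\<^bsub>H\<^esub> h, act (inv\<^bsub>H\<^esub> h) (inv\<^bsub>N\<^esub> x))"])
        (use p in \<open>auto simp: semidirect_def comp[symmetric]\<close>)
  qed (auto simp: semidirect_def comp H.m_assoc N.m_assoc)
qed

text \<open>Inside the semidirect product, the abstract action becomes conjugation: $h^{-1} x h = x^h$.\<close>

lemma semidirect_conj:
  assumes "group H" and "group N" and act: "acts_by_automorphisms H N act"
    and h: "h \<in> carrier H" and x: "x \<in> carrier N"
  shows "inv\<^bsub>semidirect H N act\<^esub> (h, \<one>\<^bsub>N\<^esub>) \<otimes>\<^bsub>semidirect H N act\<^esub> (\<one>\<^bsub>H\<^esub>, x)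
           \<otimes>\<^bsub>semidirect H N act\<^esub> (h, \<one>\<^bsub>N\<^esub>) = (\<one>\<^bsub>H\<^esub>, act h x)"
proof -
  interpret H: group H by fact
  interpret N: group N by fact
  interpret S: group "semidirect H N act" by (rule group_semidirect) fact+
  have auto: "act h \<in> hom N N"
    using act h by (auto simp: acts_by_automorphisms_def iso_def)
  then have closed: "act h y \<in> carrier N" if "y \<in> carrier N" for y
    using that by (auto simp: hom_def)
  have one: "act h \<one>\<^bsub>N\<^esub> = \<one>\<^bsub>N\<^esub>"
    using hom_one[OF auto] N.group_axioms by simp
  have mem: "(h, \<one>\<^bsub>N\<^esub>) \<in> carrier (semidirect H N act)"
    "(\<one>\<^bsub>H\<^esub>, x) \<in> carrier (semidirect H N act)"
    "(\<one>\<^bsub>H\<^esub>, act h x) \<in> carrier (semidirect H N act)"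
    using h x closed by (auto simp: semidirect_def)
  have id: "act \<one>\<^bsub>H\<^esub> \<one>\<^bsub>N\<^esub> = \<one>\<^bsub>N\<^esub>"
    using act by (auto simp: acts_by_automorphisms_def)
  have "(\<one>\<^bsub>H\<^esub>, x) \<otimes>\<^bsub>semidirect H N act\<^esub> (h, \<one>\<^bsub>N\<^esub>)
      = (h, \<one>\<^bsub>N\<^esub>) \<otimes>\<^bsub>semidirect H N act\<^esub> (\<one>\<^bsub>H\<^esub>, act h x)"
    using h x closed id by (simp add: semidirect_def)
  then show ?thesis
    using mem by (simp add: S.m_assoc S.inv_solve_left')
qed

end

theory Submission
  imports Defs "HOL-Library.Function_Algebras"
begin

text \<open>
  The linear span \<open>A\<close> of \<open>G\<close> in the matrix algebra has dimension at most $n^2$ and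
  contains the identity. Since $\varphi$ acts on \<open>G\<close> as conjugation by $g_\varphi$, its action
  extends linearly to \<open>A\<close>, and $a \cdot (\varphi, g) = a^\varphi g$ is a right linear action of
  the semidirect product on \<open>A\<close>. Evaluating at \<open>a = 1\<close> shows that its kernel meets \<open>G\<close> trivially,
  so the direct sum with the given representation of the quotient \<open>\<Phi>\<close> is faithful,
  of size at most $m + n^2 \le m^2 + n^4$.
\<close>

section \<open>Homomorphisms into the general linear group\<close>

lemma carrier_GL_D: "A \<in> carrier (GL n) \<Longrightarrow> A \<in> carrier_mat n n"
  by (auto simp: GL_def units_of_def Units_def ring_mat_simps)

lemma mult_GL [simp]: "A \<otimes>\<^bsub>GL n\<^esub> B = A * B"
  by (simp add: GL_def units_of_def ring_mat_simps)

lemma one_GL [simp]: "\<one>\<^bsub>GL n\<^esub> = 1\<^sub>m n"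
  by (simp add: GL_def units_of_def ring_mat_simps)

text \<open>Invertibility comes for free: the images of an element and of its inverse multiply to
  the identity on both sides, so a multiplicative unital map into the \<open>d\<close> by
  \<open>d\<close> matrices lands in \<open>GL d\<close>.\<close>

lemma hom_GL_I:
  assumes "group H"
    and carr: "\<And>s. s \<in> carrier H \<Longrightarrow> \<rho> s \<in> carrier_mat d d"
    and mult: "\<And>s t. s \<in> carrier H \<Longrightarrow> t \<in> carrier H \<Longrightarrow> \<rho> (s \<otimes>\<^bsub>H\<^esub> t) = \<rho> s * \<rho> t"
    and one: "\<rho> \<one>\<^bsub>H\<^esub> = 1\<^sub>m d"
  shows "\<rho> \<in> hom H (GL d)"
proof (rule homI)
  interpret group H by fact
  fix s assume s: "s \<in> carrier H"
  have "\<rho> s * \<rho> (inv\<^bsub>H\<^esub> s) = 1\<^sub>m d" "\<rho> (inv\<^bsub>H\<^esub> s) * \<rho> s = 1\<^sub>m d"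
    using mult[of s "inv\<^bsub>H\<^esub> s"] mult[of "inv\<^bsub>H\<^esub> s" s] s one by simp_all
  then show "\<rho> s \<in> carrier (GL d)"
    using carr[of s] carr[of "inv\<^bsub>H\<^esub> s"] s
    by (auto simp: GL_def units_of_def Units_def ring_mat_simps)
qed (simp add: mult)

section \<open>Matrices of a linear right action on a spanning set\<close>

context vector_space
begin

text \<open>A basis of the span of \<open>X\<close> can be chosen inside \<open>X\<close>, where
  \<open>r\<close> is controlled. Each \<open>r s\<close> agrees on \<open>X\<close> with a linear
  map, so its matrix in that basis determines it on all of \<open>X\<close>. The last conclusion
  records this and is what faithfulness will rest on.\<close>

lemma matrix_rep_of_linear_right_action:
  fixes H :: "('h, 'i) monoid_scheme"
  assumes T: "finite T" "X \<subseteq> span T"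
    and closed: "\<And>s x. s \<in> carrier H \<Longrightarrow> x \<in> X \<Longrightarrow> r s x \<in> X"
    and mult: "\<And>s t x. s \<in> carrier H \<Longrightarrow> t \<in> carrier H \<Longrightarrow> x \<in> X \<Longrightarrow> r (s \<otimes>\<^bsub>H\<^esub> t) x = r t (r s x)"
    and one: "\<And>x. x \<in> X \<Longrightarrow> r \<one>\<^bsub>H\<^esub> x = x"
    and linear: "\<And>s. s \<in> carrier H \<Longrightarrow> \<exists>L. Vector_Spaces.linear scale scale L \<and> (\<forall>x\<in>X. L x = r s x)"
  obtains d and \<rho> :: "'h \<Rightarrow> 'a mat" where "d \<le> card T"
    "\<And>s. s \<in> carrier H \<Longrightarrow> \<rho> s \<in> carrier_mat d d"
    "\<And>s t. s \<in> carrier H \<Longrightarrow> t \<in> carrier H \<Longrightarrow> \<rho> (s \<otimes>\<^bsub>H\<^esub> t) = \<rho> s * \<rho> t"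
    "\<rho> \<one>\<^bsub>H\<^esub> = 1\<^sub>m d"
    "\<And>s t x. s \<in> carrier H \<Longrightarrow> t \<in> carrier H \<Longrightarrow> \<rho> s = \<rho> t \<Longrightarrow> x \<in> X \<Longrightarrow> r s x = r t x"
proof -
  obtain B where B: "B \<subseteq> X" "independent B" "X \<subseteq> span B"
    by (rule maximal_independent_subset)
  have fin: "finite B" and card: "card B \<le> card T"
    using independent_span_bound[OF T(1) B(2)] B(1) T(2) by auto
  define d where "d = card B"
  obtain b where b: "bij_betw b {..<d} B"
    using ex_bij_betw_nat_finite[OF fin] unfolding d_def by (auto simp: atLeast0LessThan)
  have bB: "b i \<in> B" if "i < d" for i
    using b that by (auto simp: bij_betw_def)
  have bX: "b i \<in> X" if "i < d" for i
    using bB that B(1) by auto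
  let ?c = "representation B"
  have expand: "(\<Sum>i<d. ?c x (b i) *s b i) = x" if "x \<in> X" for x
  proof -
    have "(\<Sum>i<d. ?c x (b i) *s b i) = (\<Sum>y\<in>B. ?c x y *s y)"
      by (rule sum.reindex_bij_betw[OF b])
    also have "\<dots> = x"
      using sum_representation_eq[OF B(2) _ fin order_refl] that B(3) by auto
    finally show ?thesis .
  qed
  \<comment> \<open>Coordinates of the image of \<open>b j\<close> fill row \<open>j\<close>, not
    column \<open>j\<close>: row vectors turn a right action into a homomorphism instead of an
    anti-homomorphism.\<close>
  define \<rho> where "\<rho> s = mat d d (\<lambda>(j, i). ?c (r s (b j)) (b i))" for s
  have "\<rho> (s \<otimes>\<^bsub>H\<^esub> t) = \<rho> s * \<rho> t" if s: "s \<in> carrier H" and t: "t \<in> carrier H" for s t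
  proof (rule eq_matI)
    fix j k assume "j < dim_row (\<rho> s * \<rho> t)" "k < dim_col (\<rho> s * \<rho> t)"
    then have j: "j < d" and k: "k < d" by (auto simp: \<rho>_def)
    obtain L where L: "Vector_Spaces.linear scale scale L" "\<forall>x\<in>X. L x = r t x"
      using linear[OF t] by auto
    interpret L: Vector_Spaces.linear scale scale L by fact
    have sj: "r s (b j) \<in> X" using closed s bX j by auto
    have tX: "r t (b i) \<in> span B" if "i < d" for i using closed t bX that B(3) by blast
    have "r (s \<otimes>\<^bsub>H\<^esub> t) (b j) = L (r s (b j))"
      using mult s t bX j sj L(2) by auto
    \<comment> \<open>The expansion of \<open>r s (b j)\<close> has partial sums that may leave
      \<open>X\<close>; the linear extension \<open>L\<close> of \<open>r t\<close> can still be
      distributed over it, and each \<open>b i\<close> lies in \<open>X\<close>, where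
      \<open>L\<close> is \<open>r t\<close> again.\<close>
    also have "\<dots> = L (\<Sum>i<d. ?c (r s (b j)) (b i) *s b i)"
      using expand[OF sj] by simp
    also have "\<dots> = (\<Sum>i<d. ?c (r s (b j)) (b i) *s r t (b i))"
      using L(2) bX by (simp add: L.sum L.scale)
    finally have "?c (r (s \<otimes>\<^bsub>H\<^esub> t) (b j)) (b k) =
        ?c (\<Sum>i<d. ?c (r s (b j)) (b i) *s r t (b i)) (b k)"
      by simp
    \<comment> \<open>Coordinates default to zero outside the span of \<open>B\<close>, so their
      additivity and homogeneity require \<open>tX\<close>.\<close>
    also have "\<dots> = (\<Sum>i<d. ?c (?c (r s (b j)) (b i) *s r t (b i)) (b k))"
      using tX by (subst representation_sum[OF B(2)]) (auto intro: span_scale)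
    also have "\<dots> = (\<Sum>i<d. ?c (r s (b j)) (b i) * ?c (r t (b i)) (b k))"
      using tX by (intro sum.cong) (auto simp: representation_scale[OF B(2)])
    finally have "?c (r (s \<otimes>\<^bsub>H\<^esub> t) (b j)) (b k) =
        (\<Sum>i<d. ?c (r s (b j)) (b i) * ?c (r t (b i)) (b k))" .
    then show "\<rho> (s \<otimes>\<^bsub>H\<^esub> t) $$ (j, k) = (\<rho> s * \<rho> t) $$ (j, k)"
      using j k by (simp add: \<rho>_def scalar_prod_def atLeast0LessThan)
  qed (auto simp: \<rho>_def)
  moreover have "\<rho> \<one>\<^bsub>H\<^esub> = 1\<^sub>m d"
  proof (rule eq_matI)
    fix j k assume "j < dim_row (1\<^sub>m d)" "k < dim_col (1\<^sub>m d)"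
    then show "\<rho> \<one>\<^bsub>H\<^esub> $$ (j, k) = 1\<^sub>m d $$ (j, k)"
      using one bX bB b representation_basis[OF B(2) bB]
      by (auto simp: \<rho>_def bij_betw_def inj_on_def)
  qed (auto simp: \<rho>_def)
  moreover have "r s x = r t x"
    if s: "s \<in> carrier H" and t: "t \<in> carrier H" and eq: "\<rho> s = \<rho> t" and x: "x \<in> X" for s t x
  proof -
    obtain L where L: "Vector_Spaces.linear scale scale L" "\<forall>x\<in>X. L x = r s x"
      using linear[OF s] by auto
    obtain M where M: "Vector_Spaces.linear scale scale M" "\<forall>x\<in>X. M x = r t x"
      using linear[OF t] by auto
    interpret vector_space_pair scale scale ..
    have "L y = M y" if y: "y \<in> B" for y
    proof -
      obtain j where j: "j < d" "y = b j" using b y by (auto simp: bij_betw_def)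
      have "?c (r s (b j)) (b i) = ?c (r t (b j)) (b i)" if "i < d" for i
        using arg_cong[OF eq, of "\<lambda>A. A $$ (j, i)"] j that by (simp add: \<rho>_def)
      then have "(\<Sum>i<d. ?c (r s (b j)) (b i) *s b i) = (\<Sum>i<d. ?c (r t (b j)) (b i) *s b i)"
        by simp
      then have "r s (b j) = r t (b j)"
        using expand closed s t bX j by simp
      then show ?thesis using L M bX j by simp
    qed
    then have "L x = M x"
      using linear_eq_on[OF L(1) M(1)] x B(3) by blast
    then show ?thesis using L M x by simp
  qed
  moreover have "\<rho> s \<in> carrier_mat d d" for s by (simp add: \<rho>_def)
  ultimately show thesis using that card d_def by blast
qed

end

section \<open>Square matrices as vectors\<close>

text \<open>The type of matrices carries no vector space structure, so square matrices of size \<open>n\<close> are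
  embedded into the space of functions \<open>nat \<times> nat \<Rightarrow> 'k\<close>.\<close>

definition entries :: "nat \<Rightarrow> 'k::field mat \<Rightarrow> nat \<times> nat \<Rightarrow> 'k" where
  "entries n A = (\<lambda>(i, j). if i < n \<and> j < n then A $$ (i, j) else 0)"

lemma entries_inj:
  assumes "A \<in> carrier_mat n n" "B \<in> carrier_mat n n" "entries n A = entries n B"
  shows "A = B"
proof (rule eq_matI)
  fix i j assume "i < dim_row B" "j < dim_col B"
  then show "A $$ (i, j) = B $$ (i, j)"
    using assms(1,2) fun_cong[OF assms(3), of "(i, j)"] by (simp add: entries_def)
qed (use assms in auto)

definition sandwich :: "nat \<Rightarrow> 'k::field mat \<Rightarrow> 'k mat \<Rightarrow> (nat \<times> nat \<Rightarrow> 'k) \<Rightarrow> nat \<times> nat \<Rightarrow> 'k" where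
  "sandwich n P Q f =
     (\<lambda>(i, j). if i < n \<and> j < n then \<Sum>k<n. P $$ (i, k) * (\<Sum>l<n. f (k, l) * Q $$ (l, j)) else 0)"

lemma sandwich_entries:
  assumes "P \<in> carrier_mat n n" "A \<in> carrier_mat n n" "Q \<in> carrier_mat n n"
  shows "sandwich n P Q (entries n A) = entries n (P * A * Q)"
  using assms by (auto simp: fun_eq_iff sandwich_def entries_def scalar_prod_def atLeast0LessThan)

definition fscale :: "'k::field \<Rightarrow> ('i \<Rightarrow> 'k) \<Rightarrow> 'i \<Rightarrow> 'k" where
  "fscale c f = (\<lambda>i. c * f i)"

interpretation fscale: vector_space fscale
  by unfold_locales (auto simp: fscale_def fun_eq_iff algebra_simps)

lemma linear_sandwich: "Vector_Spaces.linear fscale fscale (sandwich n P Q)"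
  by unfold_locales
    (auto simp: sandwich_def fscale_def fun_eq_iff algebra_simps sum.distrib sum_distrib_left)

lemma sum_apply_fun: "(\<Sum>p\<in>I. f p) x = (\<Sum>p\<in>I. f p x)"
  by (induction I rule: infinite_finite_induct) auto

text \<open>The matrix units, encoded as indicator functions of the index pairs below
  \<open>n\<close>, span all encodings; there are at most \<open>n ^ 2\<close> of them.\<close>

lemma entries_in_span:
  obtains T :: "(nat \<times> nat \<Rightarrow> 'k::field) set"
  where "finite T" "card T \<le> n ^ 2" "\<And>A. entries n A \<in> fscale.span T"
proof
  let ?I = "{..<n} \<times> {..<n}"
  let ?T = "(\<lambda>p q. if q = p then 1 else 0 :: 'k) ` ?I"
  show "finite ?T" by simp
  show "card ?T \<le> n ^ 2"
    using card_image_le[of ?I] by (simp add: power2_eq_square)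
  fix A :: "'k mat"
  have "entries n A = (\<Sum>p\<in>?I. fscale (A $$ p) (\<lambda>q. if q = p then 1 else 0))"
    by (auto simp: fun_eq_iff entries_def fscale_def sum_apply_fun if_distrib cong: if_cong)
  also have "\<dots> \<in> fscale.span ?T"
    by (intro fscale.span_sum fscale.span_scale fscale.span_base) auto
  finally show "entries n A \<in> fscale.span ?T" .
qed

section \<open>The semidirect product acting on the span of \<open>G\<close>\<close>

theorem theorem1:
  fixes m n :: nat
    and \<Phi> G :: "'k::field mat set"
    and act :: "'k mat \<Rightarrow> 'k mat \<Rightarrow> 'k mat"
  defines "S \<equiv> semidirect ((GL m)\<lparr>carrier := \<Phi>\<rparr>) ((GL n)\<lparr>carrier := G\<rparr>) act"
  assumes "subgroup \<Phi> (GL m)"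
    and "subgroup G (GL n)"
    and "acts_by_automorphisms ((GL m)\<lparr>carrier := \<Phi>\<rparr>) ((GL n)\<lparr>carrier := G\<rparr>) act"
    and "\<forall>\<phi>\<in>\<Phi>. \<exists>a\<in>carrier (GL n). \<forall>g\<in>G.
           inv\<^bsub>S\<^esub> (\<phi>, \<one>\<^bsub>GL n\<^esub>) \<otimes>\<^bsub>S\<^esub> (\<one>\<^bsub>GL m\<^esub>, g) \<otimes>\<^bsub>S\<^esub> (\<phi>, \<one>\<^bsub>GL n\<^esub>)
             = (\<one>\<^bsub>GL m\<^esub>, inv\<^bsub>GL n\<^esub> a \<otimes>\<^bsub>GL n\<^esub> g \<otimes>\<^bsub>GL n\<^esub> a)"
  shows "\<exists>d\<le>m ^ 2 + n ^ 4. has_faithful_rep S TYPE('k) d"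
proof -
  note sub_Phi = assms(2) and sub_G = assms(3) and act = assms(4) and conj = assms(5)
  let ?H = "(GL m)\<lparr>carrier := \<Phi>\<rparr>" and ?N = "(GL n)\<lparr>carrier := G\<rparr>"
  interpret GLn: group "GL n :: 'k mat monoid" by (rule group_GL)
  interpret GLm: group "GL m :: 'k mat monoid" by (rule group_GL)
  have H: "group ?H" using GLm.subgroup_imp_group sub_Phi by simp
  have N: "group ?N" using GLn.subgroup_imp_group sub_G by simp
  have S: "group S" unfolding S_def by (rule group_semidirect[OF H N act])
  have Phi_carr: "\<phi> \<in> carrier_mat m m" if "\<phi> \<in> \<Phi>" for \<phi>
    using that subgroup.subset[OF sub_Phi] carrier_GL_D by blast
  have G_carr: "g \<in> carrier_mat n n" if "g \<in> G" for g
    using that subgroup.subset[OF sub_G] carrier_GL_D by blast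
  have one_G: "1\<^sub>m n \<in> G"
    using subgroup.one_closed[OF sub_G] by simp
  have mult_G: "g * h \<in> G" if "g \<in> G" "h \<in> G" for g h
    using subgroup.m_closed[OF sub_G] that by simp
  have act_hom: "act \<phi> \<in> hom ?N ?N" if "\<phi> \<in> \<Phi>" for \<phi>
    using act that by (auto simp: acts_by_automorphisms_def iso_def)
  have act_G: "act \<phi> g \<in> G" if "\<phi> \<in> \<Phi>" "g \<in> G" for \<phi> g
    using act_hom that by (auto simp: hom_def)
  have act_mult: "act \<phi> (g * h) = act \<phi> g * act \<phi> h" if "\<phi> \<in> \<Phi>" "g \<in> G" "h \<in> G" for \<phi> g h
    using act_hom that by (auto simp: hom_def)
  have act_one: "act \<phi> (1\<^sub>m n) = 1\<^sub>m n" if "\<phi> \<in> \<Phi>" for \<phi>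
    using hom_one[OF act_hom[OF that] N N] by simp
  have act_id: "act (1\<^sub>m m) g = g" if "g \<in> G" for g
    using act that by (auto simp: acts_by_automorphisms_def)
  have act_comp: "act (\<phi> * \<psi>) g = act \<psi> (act \<phi> g)" if "\<phi> \<in> \<Phi>" "\<psi> \<in> \<Phi>" "g \<in> G" for \<phi> \<psi> g
    using act that by (auto simp: acts_by_automorphisms_def)
  \<comment> \<open>By \<open>semidirect_conj\<close> the hypothesis says that
    \<open>act \<phi>\<close> is conjugation by some \<open>a\<close>. Only the two-sided product
    form, with \<open>P\<close> the inverse of \<open>a\<close> and \<open>Q = a\<close>, is kept,
    as it already gives linearity.\<close>
  have act_conj: "\<exists>P Q. P \<in> carrier_mat n n \<and> Q \<in> carrier_mat n n \<and> (\<forall>g\<in>G. act \<phi> g = P * g * Q)"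
    if \<phi>: "\<phi> \<in> \<Phi>" for \<phi>
  proof -
    obtain a where a: "a \<in> carrier (GL n)"
      and eq: "\<And>g. g \<in> G \<Longrightarrow> inv\<^bsub>S\<^esub> (\<phi>, \<one>\<^bsub>GL n\<^esub>) \<otimes>\<^bsub>S\<^esub> (\<one>\<^bsub>GL m\<^esub>, g) \<otimes>\<^bsub>S\<^esub> (\<phi>, \<one>\<^bsub>GL n\<^esub>)
             = (\<one>\<^bsub>GL m\<^esub>, inv\<^bsub>GL n\<^esub> a \<otimes>\<^bsub>GL n\<^esub> g \<otimes>\<^bsub>GL n\<^esub> a)"
      using conj \<phi> by blast
    have "act \<phi> g = inv\<^bsub>GL n\<^esub> a * g * a" if "g \<in> G" for g
      using semidirect_conj[OF H N act, of \<phi> g] eq[OF that] \<phi> that by (simp add: S_def)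
    then show ?thesis
      using carrier_GL_D[OF a] carrier_GL_D[OF GLn.inv_closed[OF a]] by blast
  qed
  have carrS: "carrier S = \<Phi> \<times> G" and oneS: "\<one>\<^bsub>S\<^esub> = (1\<^sub>m m, 1\<^sub>m n)"
    and multS: "(\<phi>, g) \<otimes>\<^bsub>S\<^esub> (\<psi>, h) = (\<phi> * \<psi>, act \<psi> g * h)" for \<phi> g \<psi> h
    by (simp_all add: S_def semidirect_def)

  \<comment> \<open>The action sends \<open>x\<close> to \<open>act \<phi> x * g\<close>. It is
    transported to encodings by decoding with \<open>the_inv_into\<close>, so it is meaningful on
    \<open>entries n\<close> applied to \<open>G\<close>, a spanning set of the encoded
    algebra.\<close>
  define r where "r = (\<lambda>(\<phi>, g) f. entries n (act \<phi> (the_inv_into G (entries n) f) * g))"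
  have "inj_on (entries n) G"
    by (intro inj_onI) (metis entries_inj G_carr)
  then have r: "r (\<phi>, g) (entries n x) = entries n (act \<phi> x * g)" if "x \<in> G" for \<phi> g x
    using that by (simp add: r_def the_inv_into_f_f)
  obtain T :: "(nat \<times> nat \<Rightarrow> 'k) set"
    where T: "finite T" "card T \<le> n ^ 2" "\<And>A. entries n A \<in> fscale.span T"
    by (rule entries_in_span[where n = n]) blast
  have r_mult: "r (s \<otimes>\<^bsub>S\<^esub> t) x = r t (r s x)"
    if st: "s \<in> carrier S" "t \<in> carrier S" and x: "x \<in> entries n ` G" for s t x
  proof -
    obtain \<phi> g \<psi> h y where *: "s = (\<phi>, g)" "t = (\<psi>, h)" "x = entries n y"
      "\<phi> \<in> \<Phi>" "\<psi> \<in> \<Phi>" "g \<in> G" "h \<in> G" "y \<in> G"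
      using st x by (auto simp: carrS)
    \<comment> \<open>Acting by \<open>s\<close> and then by \<open>t\<close> gives
      \<open>act \<psi> (act \<phi> y * g) * h\<close>; after regrouping,
      \<open>act \<psi> g * h\<close> is the second component of the product of \<open>s\<close> and
      \<open>t\<close>.\<close>
    have "act \<psi> (act \<phi> y) * (act \<psi> g * h) = act \<psi> (act \<phi> y) * act \<psi> g * h"
      using * by (intro assoc_mult_mat[symmetric, of _ n n _ n _ n] G_carr act_G) auto
    then show ?thesis
      using * by (simp add: multS r mult_G act_G act_comp act_mult)
  qed
  have r_linear: "\<exists>L. Vector_Spaces.linear fscale fscale L \<and> (\<forall>x\<in>entries n ` G. L x = r s x)"
    if "s \<in> carrier S" for s
  proof -
    obtain \<phi> g where s: "s = (\<phi>, g)" "\<phi> \<in> \<Phi>" "g \<in> G" using \<open>s \<in> carrier S\<close> by (auto simp: carrS)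
    obtain P Q where PQ: "P \<in> carrier_mat n n" "Q \<in> carrier_mat n n"
      "\<And>x. x \<in> G \<Longrightarrow> act \<phi> x = P * x * Q"
      using act_conj s by blast
    \<comment> \<open>Right multiplication by \<open>g\<close> is absorbed into the right factor of
      the two-sided product.\<close>
    have "sandwich n P (Q * g) (entries n x) = r s (entries n x)" if "x \<in> G" for x
    proof -
      have "P * x * (Q * g) = P * x * Q * g"
        using PQ G_carr s that by (intro assoc_mult_mat[symmetric, of _ n n _ n _ n]) auto
      then show ?thesis
        using sandwich_entries[of P n x "Q * g"] PQ G_carr that s by (simp add: r)
    qed
    then show ?thesis using linear_sandwich by blast
  qed
  obtain d and \<rho> :: "'k mat \<times> 'k mat \<Rightarrow> 'k mat" where d: "d \<le> card T"
    and \<rho>_carr: "\<And>s. s \<in> carrier S \<Longrightarrow> \<rho> s \<in> carrier_mat d d"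
    and \<rho>_mult: "\<And>s t. s \<in> carrier S \<Longrightarrow> t \<in> carrier S \<Longrightarrow> \<rho> (s \<otimes>\<^bsub>S\<^esub> t) = \<rho> s * \<rho> t"
    and \<rho>_one: "\<rho> \<one>\<^bsub>S\<^esub> = 1\<^sub>m d"
    and \<rho>_eq: "\<And>s t x. s \<in> carrier S \<Longrightarrow> t \<in> carrier S \<Longrightarrow> \<rho> s = \<rho> t \<Longrightarrow> x \<in> entries n ` G \<Longrightarrow> r s x = r t x"
  proof (rule fscale.matrix_rep_of_linear_right_action[of T "entries n ` G" S r])
    show "r s x \<in> entries n ` G" if "s \<in> carrier S" "x \<in> entries n ` G" for s x
      using that by (auto simp: carrS r mult_G act_G)
    show "r \<one>\<^bsub>S\<^esub> x = x" if "x \<in> entries n ` G" for x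
      using that by (auto simp: oneS r act_id one_G right_mult_one_mat[OF G_carr])
  qed (use T r_mult r_linear in blast)+

  \<comment> \<open>The projection to \<Phi> is a homomorphism already given by matrices of size
    \<open>m\<close>; the block sum adds it to \<rho>, which need not separate different elements of
    \<Phi>.\<close>
  define \<sigma> where "\<sigma> s = four_block_mat (fst s) (0\<^sub>m m d) (0\<^sub>m d m) (\<rho> s)" for s
  have "\<sigma> \<in> hom S (GL (m + d))"
  proof (rule hom_GL_I[OF S])
    show "\<sigma> s \<in> carrier_mat (m + d) (m + d)" if "s \<in> carrier S" for s
      using that \<rho>_carr Phi_carr by (auto simp: \<sigma>_def carrS)
    show "\<sigma> \<one>\<^bsub>S\<^esub> = 1\<^sub>m (m + d)"
      using \<rho>_one by (simp add: \<sigma>_def oneS)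
    show "\<sigma> (s \<otimes>\<^bsub>S\<^esub> t) = \<sigma> s * \<sigma> t" if st: "s \<in> carrier S" "t \<in> carrier S" for s t
    proof -
      have fst: "fst s \<in> carrier_mat m m" "fst t \<in> carrier_mat m m"
        using st Phi_carr by (auto simp: carrS)
      have "fst (s \<otimes>\<^bsub>S\<^esub> t) = fst s * fst t"
        by (cases s, cases t) (simp add: multS)
      then show ?thesis
        unfolding \<sigma>_def
        by (subst mult_four_block_mat[OF fst(1) _ _ \<rho>_carr[OF st(1)] fst(2) _ _ \<rho>_carr[OF st(2)]])
          (use fst \<rho>_carr[OF st(1)] \<rho>_carr[OF st(2)] \<rho>_mult[OF st] in auto)
    qed
  qed
  moreover have "inj_on \<sigma> (carrier S)"
  proof (rule inj_onI)
    fix s t assume st: "s \<in> carrier S" "t \<in> carrier S" and eq: "\<sigma> s = \<sigma> t"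
    obtain \<phi> g \<psi> h where *: "s = (\<phi>, g)" "t = (\<psi>, h)" "\<phi> \<in> \<Phi>" "\<psi> \<in> \<Phi>" "g \<in> G" "h \<in> G"
      using st by (auto simp: carrS)
    have entry: "\<sigma> s $$ (i, j) = \<sigma> t $$ (i, j)" for i j using eq by simp
    have "\<phi> = \<psi>"
    proof (rule eq_matI)
      fix i j assume "i < dim_row \<psi>" "j < dim_col \<psi>"
      then show "\<phi> $$ (i, j) = \<psi> $$ (i, j)"
        using entry[of i j] * Phi_carr[of \<phi>] Phi_carr[of \<psi>] by (simp add: \<sigma>_def)
    qed (use * Phi_carr in auto)
    \<comment> \<open>The lower right block starts at index \<open>m\<close> in both
      directions.\<close>
    have "\<rho> s = \<rho> t"
    proof (rule eq_matI)
      fix i j assume "i < dim_row (\<rho> t)" "j < dim_col (\<rho> t)"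
      then show "\<rho> s $$ (i, j) = \<rho> t $$ (i, j)"
        using entry[of "m + i" "m + j"] * Phi_carr[of \<phi>] Phi_carr[of \<psi>] \<rho>_carr[OF st(1)] \<rho>_carr[OF st(2)]
        by (simp add: \<sigma>_def)
    qed (use \<rho>_carr[OF st(1)] \<rho>_carr[OF st(2)] in auto)
    \<comment> \<open>Every \<open>act \<phi>\<close> fixes the identity, so acting on it returns
      the second component of the group element.\<close>
    then have "r s (entries n (1\<^sub>m n)) = r t (entries n (1\<^sub>m n))"
      using \<rho>_eq st one_G by blast
    then have "entries n g = entries n h"
      using * one_G by (simp add: r act_one left_mult_one_mat[OF G_carr])
    then show "s = t"
      using * \<open>\<phi> = \<psi>\<close> G_carr entries_inj by blast
  qed
  ultimately have "has_faithful_rep S TYPE('k) (m + d)"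
    unfolding has_faithful_rep_def by blast
  moreover have "m + d \<le> m ^ 2 + n ^ 4"
  proof -
    \<comment> \<open>Used for \<open>k = m\<close> and for \<open>k = n ^ 2\<close>, since
      \<open>d\<close> is at most \<open>n ^ 2\<close>.\<close>
    have "k \<le> k ^ 2" for k :: nat by (simp add: power2_nat_le_imp_le)
    from this[of m] this[of "n ^ 2"] show ?thesis
      using d T(2) by simp
  qed
  ultimately show ?thesis by blast
qed

end
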